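(* Let an admissible frontier with all variables equal to $1$ be given, and suppose that the frontier is ultimately periodic. Let $t:\mathbb Z^2\to\mathbb Q$ be the associated $SL_2$-tiling. Then each ray associated to $t$ is $\mathbb N$-rational; that is, for every point $M\in\mathbb Z^2$ and every nonzero vector $V\in\mathbb Z^2$, the sequence $a_n=t(M+nV)$, $n\in\mathbb N$, is $\mathbb N$-rational.
   Context: The plane $\mathbb Z^2$ is drawn with first coordinate axis pointing right and second coordinate axis pointing down. An $SL_2$-tiling of the plane over a field $K$ is a map $t:\mathbb Z^2\to K$ with $t(u,v)t(u+1,v+1)-t(u+1,v)t(u,v+1)=1$ for all $u,v\in\mathbb Z$. A frontier with all variables equal to $1$ is a bi-infinite word $(x_i)_{i\in\mathbb Z}$ over the alphabet $\{x,y\}$; it is admissible if neither $(x_n)_{n\ge0}$ nor $(x_n)_{n\le0}$ is ultimately constant; it is ultimately periodic if both $(x_n)_{n\ge0}$ and $(x_{-n})_{n\ge0}$ are ultimately periodic. It is embedded in the plane (uniquely up to translation) by choosing points $P_i\in\mathbb Z^2$ ($i\in\mathbb Z$) with $P_i-P_{i-1}=(1,0)$ if $x_i=x$ and $P_i-P_{i-1}=(0,-1)$ if $x_i=y$; the $P_i$ are the points of the frontier. For an admissible frontier there is a unique $SL_2$-tiling $t:\mathbb Z^2\to\mathbb Q$ with $t(P_i)=1$ for all $i$; it takes positive integer values and is called the $SL_2$-tiling associated to the frontier. A sequence $(a_n)_{n\ge0}$ of natural numbers is $\mathbb N$-rational if there exist $d\ge1$ and matrices $\lambda\in\mathbb N^{1\times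 d}$, $M\in\mathbb N^{d\times d}$, $\gamma\in\mathbb N^{d\times 1}$ such that $a_n=\lambda M^n\gamma$ for all $n\in\mathbb N$. *)

theory Defs
  imports Complex_Main "HOL-Library.Product_Plus" "Jordan_Normal_Form.Matrix"
begin

text \<open>Points of the plane have type \<^typ>\<open>int \<times> int\<close>; the first axis points right and the
  second one points down, so \<open>(0, -1)\<close> is a unit step upwards.\<close>

definition SL2_tiling :: "(int \<times> int \<Rightarrow> 'a::field) \<Rightarrow> bool" where
  "SL2_tiling t \<longleftrightarrow>
     (\<forall>u v. t (u, v) * t (u + 1, v + 1) - t (u + 1, v) * t (u, v + 1) = 1)"

datatype letter = X | Y

definition ultimately_constant :: "(nat \<Rightarrow> 'a) \<Rightarrow> bool" where
  "ultimately_constant s \<longleftrightarrow> (\<exists>N c. \<forall>n\<ge>N. s n = c)"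

definition ultimately_periodic :: "(nat \<Rightarrow> 'a) \<Rightarrow> bool" where
  "ultimately_periodic s \<longleftrightarrow> (\<exists>N p. p \<ge> 1 \<and> (\<forall>n\<ge>N. s (n + p) = s n))"

definition admissible :: "(int \<Rightarrow> letter) \<Rightarrow> bool" where
  "admissible x \<longleftrightarrow>
     \<not> ultimately_constant (\<lambda>n. x (int n)) \<and> \<not> ultimately_constant (\<lambda>n. x (- int n))"

definition ultimately_periodic_frontier :: "(int \<Rightarrow> letter) \<Rightarrow> bool" where
  "ultimately_periodic_frontier x \<longleftrightarrow>
     ultimately_periodic (\<lambda>n. x (int n)) \<and> ultimately_periodic (\<lambda>n. x (- int n))"

text \<open>\<open>P\<close> is one of the embeddings of the word \<open>x\<close> in the plane (they differ by translations).\<close>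

definition frontier_embedding :: "(int \<Rightarrow> letter) \<Rightarrow> (int \<Rightarrow> int \<times> int) \<Rightarrow> bool" where
  "frontier_embedding x P \<longleftrightarrow>
     (\<forall>i. P i - P (i - 1) = (case x i of X \<Rightarrow> (1, 0) | Y \<Rightarrow> (0, -1)))"

text \<open>For the points \<open>P\<close> of an admissible frontier exactly one \<open>t\<close> satisfies this predicate.\<close>

definition associated_tiling :: "(int \<Rightarrow> int \<times> int) \<Rightarrow> (int \<times> int \<Rightarrow> rat) \<Rightarrow> bool" where
  "associated_tiling P t \<longleftrightarrow> SL2_tiling t \<and> (\<forall>i. t (P i) = 1)"

definition N_rational :: "(nat \<Rightarrow> nat) \<Rightarrow> bool" where
  "N_rational a \<longleftrightarrow>
     (\<exists>d \<ge> 1. \<exists>l \<in> carrier_mat 1 d. \<exists>A \<in> carrier_mat d d. \<exists>g \<in> carrier_mat d 1.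
        \<forall>n. a n = (l * (A ^\<^sub>m n) * g) $$ (0, 0))"

text \<open>The sequence \<open>t (M + n V)\<close>.\<close>

definition ray :: "(int \<times> int \<Rightarrow> 'a) \<Rightarrow> int \<times> int \<Rightarrow> int \<times> int \<Rightarrow> nat \<Rightarrow> 'a" where
  "ray t M V n = t (fst M + int n * fst V, snd M + int n * snd V)"

end

theory Submission
  imports Defs
begin

text \<open>The value of the tiling at a point below the frontier depends only on the frontier segment that
  joins the row of the point to its column: with one elementary matrix over \<open>\<nat>\<close> for each of the
  letters \<open>X\<close> and \<open>Y\<close>, it is the lower right entry of the product of the matrices along that segment
  (\<open>tiling_eq_word_mat\<close>). A reflection that exchanges the letters carries the points above the
  frontier to points below it.

  Along a ray the two ends of the segment move along the frontier. Where the frontier is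
  periodic, a fixed number of rows or columns corresponds to a fixed number of periods, so after
  passing to every \<open>p\<close>-th point of the ray and dropping finitely many points, the indices of both
  ends are arithmetic progressions whose differences are multiples of the period
  (\<open>column_progression\<close>). Whether the ends move apart or in the same direction, the next
  segment arises from the previous one by attaching a fixed word on either side, so that the
  matrices of the segments satisfy \<open>W (n + 1) = A * W n * C\<close> with constant \<open>A\<close> and \<open>C\<close> over \<open>\<nat>\<close>
  (\<open>N_rational_factor_progression\<close>). Each entry of such a sequence is \<open>\<nat>\<close>-rational, since the
  recursion is linear in the four entries.

  Finally, \<open>\<nat>\<close>-rationality survives the two reductions: finitely many terms may be put in front
  (\<open>N_rational_offset\<close>), and \<open>p\<close> sequences may be interleaved (\<open>N_rational_interleave\<close>). Both
  follow from the description of \<open>\<nat>\<close>-rational sequences as the \<open>\<nat>\<close>-linear combinations of finite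
  families in which the shift of each member is an \<open>\<nat>\<close>-linear combination of members.\<close>

section \<open>Sequences of natural numbers generated by finite stable families\<close>

text \<open>The index set is left arbitrary because the families below are naturally indexed by options,
  pairs and triples; numbering it turns the recursion into a matrix.\<close>

lemma N_rational_intro:
  fixes f :: "'i \<Rightarrow> nat \<Rightarrow> nat"
  assumes fin: "finite I" and ne: "I \<noteq> {}"
    and rec: "\<And>k n. k \<in> I \<Longrightarrow> f k (Suc n) = (\<Sum>m\<in>I. A k m * f m n)"
    and a: "\<And>n. a n = (\<Sum>k\<in>I. l k * f k n)"
  shows "N_rational a"
proof -
  define d where "d = card I"
  obtain h where h: "bij_betw h {0..<d} I"
    using ex_bij_betw_nat_finite[OF fin] unfolding d_def by blast
  have d1: "d \<ge> 1"
    using fin ne by (simp add: d_def Suc_le_eq card_gt_0_iff)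
  have hI: "h r \<in> I" if "r < d" for r
    using h that by (auto simp: bij_betw_def)
  define B where "B = mat d d (\<lambda>(r, c). A (h r) (h c))"
  define G where "G n = mat d 1 (\<lambda>(r, c :: nat). f (h r) n)" for n
  define L where "L = mat 1 d (\<lambda>(r :: nat, c). l (h c))"
  have car: "B \<in> carrier_mat d d" "G n \<in> carrier_mat d 1" "L \<in> carrier_mat 1 d" for n
    by (simp_all add: B_def G_def L_def)
  have step: "B * G n = G (Suc n)" for n
  proof (rule eq_matI)
    fix r c assume "r < dim_row (G (Suc n))" "c < dim_col (G (Suc n))"
    then have r: "r < d" and c: "c = 0" by (simp_all add: G_def)
    have "(B * G n) $$ (r, c) = (\<Sum>m = 0..<d. A (h r) (h m) * f (h m) n)"
      using r c by (simp add: B_def G_def scalar_prod_def)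
    also have "\<dots> = (\<Sum>m\<in>I. A (h r) m * f m n)"
      by (rule sum.reindex_bij_betw[OF h])
    also have "\<dots> = G (Suc n) $$ (r, c)"
      using r c by (simp add: G_def rec[OF hI])
    finally show "(B * G n) $$ (r, c) = G (Suc n) $$ (r, c)" .
  qed (simp_all add: B_def G_def)
  have pow: "B ^\<^sub>m n * G s = G (s + n)" for n s
  proof (induction n arbitrary: s)
    case 0
    have "dim_row B = d" by (simp add: B_def)
    then show ?case using car(2)[of s] by simp
  next
    case (Suc n)
    have "B ^\<^sub>m Suc n * G s = B ^\<^sub>m n * (B * G s)"
      using car by (simp add: assoc_mult_mat[of _ d d _ d _ 1])
    then show ?case using Suc by (simp add: step)
  qed
  have "a n = (L * (B ^\<^sub>m n) * G 0) $$ (0, 0)" for n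
  proof -
    have "L * (B ^\<^sub>m n) * G 0 = L * G n"
      using car pow[of n 0] by (simp add: assoc_mult_mat[of _ 1 d _ d _ 1])
    moreover have "(L * G n) $$ (0, 0) = (\<Sum>m = 0..<d. l (h m) * f (h m) n)"
      by (simp add: L_def G_def scalar_prod_def)
    moreover have "\<dots> = a n"
      unfolding a by (rule sum.reindex_bij_betw[OF h])
    ultimately show ?thesis by simp
  qed
  then show ?thesis
    unfolding N_rational_def using d1 car by blast
qed

text \<open>Conversely, the coordinates of the vectors \<open>M\<^sup>n \<gamma>\<close> form such a family.\<close>

lemma N_rational_elim:
  assumes "N_rational a"
  obtains d :: nat and f A l where "d \<ge> 1"
    and "\<And>k n. k < d \<Longrightarrow> f k (Suc n) = (\<Sum>m<d. A k m * f m n)"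
    and "\<And>n. a n = (\<Sum>k<d. l k * f k n)"
proof -
  obtain d L B G where d: "d \<ge> 1" and car: "L \<in> carrier_mat 1 d" "B \<in> carrier_mat d d"
      "G \<in> carrier_mat d 1" and a: "\<And>n. a n = (L * (B ^\<^sub>m n) * G) $$ (0, 0)"
    using assms unfolding N_rational_def by blast
  define f where "f k n = (B ^\<^sub>m n * G) $$ (k, 0)" for k n
  have pc: "B ^\<^sub>m n \<in> carrier_mat d d" for n
    using car by simp
  have comm: "B ^\<^sub>m Suc n = B * B ^\<^sub>m n" for n
  proof (induction n)
    case (Suc n)
    then show ?case using car pc by (simp add: assoc_mult_mat[of _ d d _ d _ d])
  qed (use car in simp)
  show thesis
  proof (rule that[of d f "\<lambda>k m. B $$ (k, m)" "\<lambda>k. L $$ (0, k)"])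
    fix k n assume k: "k < d"
    have "B ^\<^sub>m Suc n * G = B * (B ^\<^sub>m n * G)"
      unfolding comm by (rule assoc_mult_mat[OF car(2) pc car(3)])
    then show "f k (Suc n) = (\<Sum>m<d. B $$ (k, m) * f m n)"
      using k car by (simp add: f_def scalar_prod_def lessThan_atLeast0 del: pow_mat.simps)
  next
    fix n
    have "L * (B ^\<^sub>m n) * G = L * (B ^\<^sub>m n * G)"
      by (rule assoc_mult_mat[OF car(1) pc car(3)])
    then show "a n = (\<Sum>k<d. L $$ (0, k) * f k n)"
      using car by (simp add: a f_def scalar_prod_def lessThan_atLeast0)
  qed (use d in simp)
qed

text \<open>The first term is free: adding \<open>a\<close> itself to a stable family that generates the shift
  of \<open>a\<close> keeps the family stable.\<close>

lemma N_rational_Suc: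
  assumes "N_rational (\<lambda>n. a (Suc n))"
  shows "N_rational a"
proof -
  obtain d :: nat and f A l where "d \<ge> 1"
    and rec: "\<And>k n. k < d \<Longrightarrow> f k (Suc n) = (\<Sum>m<d. A k m * f m n)"
    and a: "\<And>n. a (Suc n) = (\<Sum>k<d. l k * f k n)"
    by (rule N_rational_elim[OF assms]) (rule that)
  define I where "I = insert None (Some ` {..<d})"
  have sum_I: "(\<Sum>m\<in>I. g m) = g None + (\<Sum>m<d. g (Some m))" for g :: "nat option \<Rightarrow> nat"
    unfolding I_def by (subst sum.insert) (auto simp: sum.reindex)
  define F where "F k = (case k of None \<Rightarrow> a | Some k \<Rightarrow> f k)" for k
  define B where "B k m = (case (k, m) of (None, Some m) \<Rightarrow> l m | (Some k, Some m) \<Rightarrow> A k m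
    | _ \<Rightarrow> 0)" for k m
  show ?thesis
  proof (rule N_rational_intro[of I F B _ "\<lambda>k. if k = None then 1 else 0"])
    fix k n assume "k \<in> I"
    then show "F k (Suc n) = (\<Sum>m\<in>I. B k m * F m n)"
      unfolding sum_I by (auto simp: I_def F_def B_def rec a split: option.splits)
  next
    show "a n = (\<Sum>k\<in>I. (if k = None then 1 else 0) * F k n)" for n
      unfolding sum_I by (simp add: F_def)
  qed (simp_all add: I_def)
qed

lemma N_rational_offset:
  assumes "N_rational (\<lambda>n. a (N + n))"
  shows "N_rational a"
  using assms
proof (induction N)
  case (Suc N)
  then show ?case
    using N_rational_Suc[of "\<lambda>n. a (N + n)"] by simp
qed simp

text \<open>Spread each member of the family of the residue class \<open>r\<close> out with step \<open>p\<close>, putting its terms at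
  the positions congruent to \<open>s\<close> and zeros elsewhere. A shift lowers \<open>s\<close> by one, and only at
  \<open>s = 0\<close> does it advance the family by one step of its recursion; so the spread-out
  sequences, over all \<open>r\<close> and \<open>s\<close>, again form a stable family.\<close>

lemma N_rational_interleave:
  assumes p: "p \<ge> 1" and r: "\<And>r. r < p \<Longrightarrow> N_rational (\<lambda>n. a (p * n + r))"
  shows "N_rational a"
proof -
  define gen where "gen r = (\<lambda>(d :: nat, f, A, l). d \<ge> 1 \<and>
      (\<forall>k n. k < d \<longrightarrow> f k (Suc n) = (\<Sum>m<d. A k m * f m n)) \<and>
      (\<forall>n. a (p * n + r) = (\<Sum>k<d. l k * f k n)))" for r
  have "\<exists>D. gen r D" if "r < p" for r
  proof (rule N_rational_elim[OF r[OF that]])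
    fix d :: nat and f A l
    assume "d \<ge> 1" "\<And>k n. k < d \<Longrightarrow> f k (Suc n) = (\<Sum>m<d. A k m * f m n)"
      "\<And>n. a (p * n + r) = (\<Sum>k<d. l k * f k n)"
    then have "gen r (d, f, A, l)" by (simp add: gen_def)
    then show ?thesis ..
  qed
  then obtain D where D: "\<And>r. r < p \<Longrightarrow> gen r (D r)" by metis
  define d where "d r = fst (D r)" for r
  define f where "f r = fst (snd (D r))" for r
  define A where "A r = fst (snd (snd (D r)))" for r
  define l where "l r = snd (snd (snd (D r)))" for r
  have gen: "d r \<ge> 1 \<and> (\<forall>k n. k < d r \<longrightarrow> f r k (Suc n) = (\<Sum>m<d r. A r k m * f r m n)) \<and>
      (\<forall>n. a (p * n + r) = (\<Sum>k<d r. l r k * f r k n))" if "r < p" for r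
    using D[OF that] by (simp add: gen_def d_def f_def A_def l_def split_def)
  have d: "d r \<ge> 1" if "r < p" for r
    using gen[OF that] by blast
  have rec: "f r k (Suc n) = (\<Sum>m<d r. A r k m * f r m n)" if "r < p" "k < d r" for r k n
    using gen[OF that(1)] that(2) by blast
  have a: "a (p * n + r) = (\<Sum>k<d r. l r k * f r k n)" if "r < p" for r n
    using gen[OF that] by blast
  define I where "I = (SIGMA r:{..<p}. {..<d r} \<times> {..<p})"
  define F where "F = (\<lambda>(r, k, s) n. if n mod p = s then f r k (n div p) else 0)"
  define B where "B = (\<lambda>(r, k, s) (r', m, s'). if r' = r \<and> s' = (if s = 0 then p - 1 else s - 1)
    then (if s = 0 then A r k m else if m = k then 1 else 0) else 0)"
  have sum_I: "(\<Sum>z\<in>I. g z) = (\<Sum>r<p. \<Sum>m<d r. \<Sum>s<p. g (r, m, s))"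
    for g :: "nat \<times> nat \<times> nat \<Rightarrow> nat"
    unfolding I_def by (simp add: sum.Sigma sum.cartesian_product split_def)
  show ?thesis
  proof (rule N_rational_intro[of I F B _ "\<lambda>(r, k, s). if s = r then l r k else 0"])
    show "finite I" by (simp add: I_def)
    have "(0, 0, 0) \<in> I" using p d[of 0] by (auto simp: I_def Suc_le_eq)
    then show "I \<noteq> {}" by blast
  next
    fix z n assume "z \<in> I"
    then obtain r k s where z: "z = (r, k, s)" "r < p" "k < d r" "s < p"
      by (auto simp: I_def)
    define s0 where "s0 = (if s = 0 then p - 1 else s - 1)"
    have s0: "s0 < p" using p z by (auto simp: s0_def)
    have "(\<Sum>w\<in>I. B z w * F w n) =
        (\<Sum>r'<p. if r' = r then (\<Sum>m<d r. \<Sum>s'<p. B z (r, m, s') * F (r, m, s') n) else 0)"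
      unfolding sum_I by (intro sum.cong) (auto simp: B_def z)
    also have "\<dots> = (\<Sum>m<d r. \<Sum>s'<p. B z (r, m, s') * F (r, m, s') n)"
      using z by simp
    also have "\<dots> = (\<Sum>m<d r. \<Sum>s'<p. if s' = s0 then B z (r, m, s0) * F (r, m, s0) n else 0)"
      by (intro sum.cong) (auto simp: B_def z s0_def)
    also have "\<dots> = (\<Sum>m<d r. B z (r, m, s0) * F (r, m, s0) n)"
      using s0 by simp
    also have "\<dots> = F z (Suc n)"
    proof (cases "s = 0")
      case True
      have "n mod p = p - Suc 0 \<longleftrightarrow> Suc (n mod p) = p" using p by auto
      then show ?thesis
        using z p True by (auto simp: B_def F_def s0_def rec mod_Suc div_Suc)
    next
      case False
      then have "(\<Sum>m<d r. B z (r, m, s0) * F (r, m, s0) n) =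
          (\<Sum>m<d r. if m = k then F (r, k, s0) n else 0)"
        by (intro sum.cong) (auto simp: B_def z s0_def)
      also have "\<dots> = F (r, k, s0) n" using z by simp
      also have "\<dots> = F z (Suc n)"
        using z p False by (auto simp: F_def s0_def mod_Suc div_Suc)
      finally show ?thesis .
    qed
    finally show "F z (Suc n) = (\<Sum>w\<in>I. B z w * F w n)" ..
  next
    fix n
    define r where "r = n mod p"
    have r: "r < p" using p by (simp add: r_def)
    have "(\<Sum>z\<in>I. (case z of (r, k, s) \<Rightarrow> if s = r then l r k else 0) * F z n) =
        (\<Sum>r'<p. \<Sum>m<d r'. \<Sum>s<p. if s = r' then (if r' = r then l r m * f r m (n div p) else 0) else 0)"
      unfolding sum_I by (intro sum.cong) (auto simp: F_def r_def)
    also have "\<dots> = (\<Sum>r'<p. \<Sum>m<d r'. if r' = r then l r m * f r m (n div p) else 0)"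
      by (intro sum.cong) simp_all
    also have "\<dots> = (\<Sum>r'<p. if r' = r then (\<Sum>m<d r. l r m * f r m (n div p)) else 0)"
      by (intro sum.cong) simp_all
    also have "\<dots> = (\<Sum>m<d r. l r m * f r m (n div p))"
      using r by simp
    also have "\<dots> = a (p * (n div p) + r)" using a[OF r] by simp
    also have "\<dots> = a n" by (simp add: r_def)
    finally show "a n = (\<Sum>z\<in>I. (case z of (r, k, s) \<Rightarrow> if s = r then l r k else 0) * F z n)" ..
  qed
qed

section \<open>Matrices of words\<close>

text \<open>The row \<open>(0, 1)\<close> is fixed by the matrix of \<open>X\<close> acting from the right, and the column with entries
  \<open>0, 1\<close> by the matrix of \<open>Y\<close> acting from the left. Hence the lower right entry of the matrix of a
  word ignores leading \<open>X\<close>s and trailing \<open>Y\<close>s, just as the corner of the frontier segment described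
  by that word does.\<close>

definition letter_mat :: "letter \<Rightarrow> nat mat" where
  "letter_mat c = (case c of X \<Rightarrow> mat_of_rows_list 2 [[1, 1], [0, 1]]
     | Y \<Rightarrow> mat_of_rows_list 2 [[1, 0], [1, 1]])"

fun word_mat :: "letter list \<Rightarrow> nat mat" where
  "word_mat [] = 1\<^sub>m 2"
| "word_mat (c # w) = letter_mat c * word_mat w"

lemma letter_mat_carrier [simp]: "letter_mat c \<in> carrier_mat 2 2"
  by (auto simp: letter_mat_def mat_of_rows_list_def split: letter.split)

lemma word_mat_carrier [simp]: "word_mat w \<in> carrier_mat 2 2"
  by (induction w) (simp_all add: mult_carrier_mat[OF letter_mat_carrier])

lemma word_mat_append: "word_mat (v @ w) = word_mat v * word_mat w"
proof (induction v)
  case Nil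
  show ?case using left_mult_one_mat[OF word_mat_carrier[of w]] by simp
next
  case (Cons c v)
  then show ?case
    by (simp add: assoc_mult_mat[of _ 2 2 _ 2 _ 2])
qed

lemma mult_mat_2_entry:
  fixes A B :: "'a :: semiring_1 mat"
  assumes "A \<in> carrier_mat 2 2" "B \<in> carrier_mat 2 2" "r < 2" "c < 2"
  shows "(A * B) $$ (r, c) = A $$ (r, 0) * B $$ (0, c) + A $$ (r, 1) * B $$ (1, c)"
  using assms by (auto simp: scalar_prod_def numeral_2_eq_2)

lemma letter_mat_entries [simp]:
  "letter_mat X $$ (0, 0) = 1" "letter_mat X $$ (0, Suc 0) = 1"
  "letter_mat X $$ (Suc 0, 0) = 0" "letter_mat X $$ (Suc 0, Suc 0) = 1"
  "letter_mat Y $$ (0, 0) = 1" "letter_mat Y $$ (0, Suc 0) = 0"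
  "letter_mat Y $$ (Suc 0, 0) = 1" "letter_mat Y $$ (Suc 0, Suc 0) = 1"
  by (simp_all add: letter_mat_def mat_of_rows_list_def)

text \<open>The determinant is 1; it is stated without subtraction because the entries are natural numbers.\<close>

lemma word_mat_det:
  "word_mat w $$ (0, 0) * word_mat w $$ (1, 1) = 1 + word_mat w $$ (0, 1) * word_mat w $$ (1, 0)"
proof (induction w)
  case (Cons c w)
  then show ?case
    by (cases c) (simp_all add: mult_mat_2_entry algebra_simps)
qed simp

text \<open>The word is read on the half-open interval from \<open>i\<close> to \<open>j\<close>: it consists of the steps that
  lead from the point of index \<open>i\<close> to the point of index \<open>j\<close>.\<close>

definition factor :: "(int \<Rightarrow> letter) \<Rightarrow> int \<Rightarrow> int \<Rightarrow> letter list" where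
  "factor x i j = map x [i + 1..j]"

lemma factor_append:
  assumes "i \<le> j" "j \<le> k"
  shows "factor x i k = factor x i j @ factor x j k"
  using assms upto_split1[of "i + 1" "j + 1" k] upto_split2[of "i + 1" j k]
  by (cases "i = j") (auto simp: factor_def)

lemma factor_shift:
  assumes "\<And>k. i < k \<Longrightarrow> k \<le> j \<Longrightarrow> x (k + d) = x k"
  shows "factor x (i + d) (j + d) = factor x i j"
  unfolding factor_def
proof (rule nth_equalityI)
  fix n
  assume "n < length (map x [i + d + 1..j + d])"
  then have n: "int n < j - i" by simp
  then show "map x [i + d + 1..j + d] ! n = map x [i + 1..j] ! n"
    using assms[of "i + 1 + int n"] by (simp add: algebra_simps)
qed simp

text \<open>\<open>W \<mapsto> A * W * C\<close> acts linearly, with coefficients in \<open>\<nat>\<close>, on the four entries of \<open>W\<close>.\<close>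

lemma N_rational_corner_entry:
  fixes W :: "nat \<Rightarrow> nat mat"
  assumes A: "A \<in> carrier_mat 2 2" and C: "C \<in> carrier_mat 2 2"
    and W: "\<And>n. W n \<in> carrier_mat 2 2" and rec: "\<And>n. W (Suc n) = A * W n * C"
  shows "N_rational (\<lambda>n. W n $$ (1, 1))"
proof (rule N_rational_intro[of "{0, 1} \<times> {0, 1}" "\<lambda>(r, c) n. W n $$ (r, c)"
      "\<lambda>(r, c) (r', c'). A $$ (r, r') * C $$ (c', c)" _ "\<lambda>z. if z = (1, 1) then 1 else 0"])
  fix z :: "nat \<times> nat" and n
  assume "z \<in> {0, 1} \<times> {0, 1}"
  then obtain r c where z: "z = (r, c)" "r < 2" "c < 2" by auto
  have AW: "A * W n \<in> carrier_mat 2 2" using A W by simp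
  show "(case z of (r, c) \<Rightarrow> \<lambda>n. W n $$ (r, c)) (Suc n) =
      (\<Sum>m\<in>{0, 1} \<times> {0, 1}. (case z of (r, c) \<Rightarrow> \<lambda>(r', c'). A $$ (r, r') * C $$ (c', c)) m *
        (case m of (r, c) \<Rightarrow> \<lambda>n. W n $$ (r, c)) n)"
    using z mult_mat_2_entry[OF AW C] mult_mat_2_entry[OF A W]
    by (simp add: rec sum.cartesian_product[symmetric] algebra_simps)
qed (simp_all add: sum.cartesian_product[symmetric])

section \<open>The tiling in terms of words\<close>

lemma frontier_step:
  assumes "frontier_embedding x P"
  shows "x i = X \<Longrightarrow> P i = (fst (P (i - 1)) + 1, snd (P (i - 1)))"
    and "x i = Y \<Longrightarrow> P i = (fst (P (i - 1)), snd (P (i - 1)) - 1)"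
proof -
  have "P i - P (i - 1) = (case x i of X \<Rightarrow> (1, 0) | Y \<Rightarrow> (0, -1))"
    using assms by (simp add: frontier_embedding_def)
  then show "x i = X \<Longrightarrow> P i = (fst (P (i - 1)) + 1, snd (P (i - 1)))"
    and "x i = Y \<Longrightarrow> P i = (fst (P (i - 1)), snd (P (i - 1)) - 1)"
    by (auto simp: prod_eq_iff)
qed

lemma factor_Cons: "i < j \<Longrightarrow> factor x i j = x (i + 1) # factor x (i + 1) j"
  by (simp add: factor_def upto_rec1)

lemma factor_snoc: "i < j \<Longrightarrow> factor x i j = factor x i (j - 1) @ [x j]"
  by (simp add: factor_def upto_rec2)

text \<open>The point in the column of \<open>P j\<close> and the row of \<open>P i\<close> is the corner below and to the right of the
  frontier segment from \<open>P i\<close> to \<open>P j\<close>. A leading \<open>X\<close> or a trailing \<open>Y\<close> can be dropped from the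
  segment without moving the corner. If the word is \<open>Y w X\<close>, the other three points of the unit
  square at the corner are the corners of the shorter words \<open>Y w\<close>, \<open>w X\<close> and \<open>w\<close>; the tiling rule
  determines the value from these three, and the matrix entries obey the same rule because the
  matrix of \<open>w\<close> has determinant 1.\<close>

lemma tiling_eq_word_mat:
  assumes emb: "frontier_embedding x P" and t: "associated_tiling P t"
    and "i \<le> j"
  shows "t (fst (P j), snd (P i)) = of_nat (word_mat (factor x i j) $$ (1, 1))"
  using \<open>i \<le> j\<close>
proof (induction "nat (j - i)" arbitrary: i j rule: less_induct)
  case less
  note step = frontier_step[OF emb]
  have one: "t (P k) = 1" for k
    using t by (simp add: associated_tiling_def)
  have sl2: "t (u, v) * t (u + 1, v + 1) - t (u + 1, v) * t (u, v + 1) = 1" for u v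
    using t by (simp add: associated_tiling_def SL2_tiling_def)
  consider "i = j" | "i < j" "x (i + 1) = X" | "i < j" "x j = Y"
    | "i < j" "x (i + 1) = Y" "x j = X"
    using less.prems by (metis letter.exhaust order_le_less)
  then show ?case
  proof cases
    case 1
    then show ?thesis using one[of i] by (simp add: factor_def)
  next
    case 2
    have "t (fst (P j), snd (P (i + 1))) = of_nat (word_mat (factor x (i + 1) j) $$ (1, 1))"
      using 2 by (intro less.hyps) auto
    then show ?thesis
      using 2 step(1)[of "i + 1"] by (simp add: factor_Cons mult_mat_2_entry)
  next
    case 3
    have "t (fst (P (j - 1)), snd (P i)) = of_nat (word_mat (factor x i (j - 1)) $$ (1, 1))"
      using 3 by (intro less.hyps) auto
    then show ?thesis
      using 3 step(2)[of j]
      by (simp add: factor_snoc word_mat_append mult_mat_2_entry right_mult_one_mat[OF letter_mat_carrier])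
  next
    case 4
    then have ij: "i + 1 < j" by (cases "j = i + 1") auto
    define w where "w = word_mat (factor x (i + 1) (j - 1))"
    have car: "w \<in> carrier_mat 2 2" by (simp add: w_def)
    \<comment> \<open>The four corners of the unit square carry \<open>d\<close>, \<open>c + d\<close>, \<open>b + d\<close> and \<open>a + b + c + d\<close>.\<close>
    define a b c d :: rat where "a = of_nat (w $$ (0, 0))" and "b = of_nat (w $$ (0, 1))"
      and "c = of_nat (w $$ (1, 0))" and "d = of_nat (w $$ (1, 1))"
    have "w $$ (0, 0) * w $$ (1, 1) = 1 + w $$ (0, 1) * w $$ (1, 0)"
      unfolding w_def by (rule word_mat_det)
    then have det: "a * d = 1 + b * c"
      unfolding a_def b_def c_def d_def by (metis of_nat_1 of_nat_add of_nat_mult)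
    then have d0: "d \<noteq> 0"
      unfolding a_def b_def c_def d_def
      by (metis add_nonneg_eq_0_iff mult_zero_right of_nat_0_le_iff of_nat_mult zero_le_one zero_neq_one)
    have pj: "fst (P (j - 1)) = fst (P j) - 1" and pi: "snd (P (i + 1)) = snd (P i) - 1"
      using 4 step(1)[of j] step(2)[of "i + 1"] by simp_all
    have m1: "t (fst (P (j - 1)), snd (P (i + 1))) = d"
      using ij by (simp add: less.hyps w_def d_def)
    have m2: "t (fst (P j), snd (P (i + 1))) = c + d"
    proof -
      have "t (fst (P j), snd (P (i + 1))) = of_nat (word_mat (factor x (i + 1) j) $$ (1, 1))"
        using ij by (intro less.hyps) auto
      also have "word_mat (factor x (i + 1) j) = w * letter_mat X"
        using ij 4 by (simp add: factor_snoc[of "i + 1" j] word_mat_append w_def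
          right_mult_one_mat[OF letter_mat_carrier])
      finally show ?thesis using car by (simp add: mult_mat_2_entry c_def d_def)
    qed
    have m3: "t (fst (P (j - 1)), snd (P i)) = b + d"
    proof -
      have "t (fst (P (j - 1)), snd (P i)) = of_nat (word_mat (factor x i (j - 1)) $$ (1, 1))"
        using ij by (intro less.hyps) auto
      also have "word_mat (factor x i (j - 1)) = letter_mat Y * w"
        using ij 4 by (simp add: factor_Cons[of i "j - 1"] w_def)
      finally show ?thesis using car by (simp add: mult_mat_2_entry b_def d_def)
    qed
    have "word_mat (factor x i j) = letter_mat Y * (w * letter_mat X)"
      using ij 4 by (simp add: factor_Cons[of i j] factor_snoc[of "i + 1" j] word_mat_append w_def
          right_mult_one_mat[OF letter_mat_carrier])
    then have m4: "of_nat (word_mat (factor x i j) $$ (1, 1)) = a + b + c + d"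
      using car by (simp add: mult_mat_2_entry a_def b_def c_def d_def)
    have "d * t (fst (P j), snd (P i)) - (c + d) * (b + d) = 1"
      using sl2[of "fst (P (j - 1))" "snd (P (i + 1))"] m1 m2 m3 by (simp add: pj pi)
    then have "d * t (fst (P j), snd (P i)) = d * (a + b + c + d)"
      using det by (simp add: algebra_simps)
    then have "t (fst (P j), snd (P i)) = a + b + c + d" using d0 by simp
    then show ?thesis by (simp only: m4)
  qed
qed

text \<open>The reflection in an antidiagonal exchanges the two sides of the frontier. Among the symmetries
  that do so it is the convenient one: it keeps the indices of the frontier points in order
  and only interchanges the two letters.\<close>

definition flip :: "letter \<Rightarrow> letter" where
  "flip c = (case c of X \<Rightarrow> Y | Y \<Rightarrow> X)"

definition reflect :: "int \<times> int \<Rightarrow> int \<times> int" where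
  "reflect = (\<lambda>(u, v). (- v, - u))"

lemma frontier_embedding_flip:
  assumes "frontier_embedding x P"
  shows "frontier_embedding (flip \<circ> x) (reflect \<circ> P)"
  unfolding frontier_embedding_def
proof
  fix i
  show "(reflect \<circ> P) i - (reflect \<circ> P) (i - 1) =
      (case (flip \<circ> x) i of X \<Rightarrow> (1, 0) | Y \<Rightarrow> (0, - 1))"
    using frontier_step[OF assms, of i]
    by (cases "x i") (auto simp: flip_def reflect_def split_def)
qed

lemma admissible_flip:
  assumes "admissible x"
  shows "admissible (flip \<circ> x)"
proof -
  have flip_flip: "flip (flip c) = c" for c by (cases c) (simp_all add: flip_def)
  have unflip: "ultimately_constant s" if "ultimately_constant (\<lambda>n. flip (s n))" for s
    using that unfolding ultimately_constant_def by (metis flip_flip)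
  show ?thesis
    using assms unflip[of "\<lambda>n. x (int n)"] unflip[of "\<lambda>n. x (- int n)"]
    by (auto simp: admissible_def)
qed

lemma associated_tiling_flip:
  assumes "associated_tiling P t"
  shows "associated_tiling (reflect \<circ> P) (t \<circ> reflect)"
  unfolding associated_tiling_def SL2_tiling_def
proof (intro conjI allI)
  fix u v :: int
  have "t (- 1 - v, - 1 - u) * t (- v, - u) - t (- v, - 1 - u) * t (- 1 - v, - u) = 1"
    using spec[OF spec[OF assms[unfolded associated_tiling_def SL2_tiling_def, THEN conjunct1],
        of "- 1 - v"], of "- 1 - u"] by simp
  then show "(t \<circ> reflect) (u, v) * (t \<circ> reflect) (u + 1, v + 1) -
      (t \<circ> reflect) (u + 1, v) * (t \<circ> reflect) (u, v + 1) = 1"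
    by (simp add: reflect_def algebra_simps)
next
  fix i
  show "(t \<circ> reflect) ((reflect \<circ> P) i) = 1"
    using assms by (simp add: associated_tiling_def reflect_def split_def)
qed

section \<open>Words that are periodic outside a bounded window\<close>

text \<open>One period \<open>q\<close> serves both ends of the word.\<close>

definition periodic_outside :: "int \<Rightarrow> int \<Rightarrow> (int \<Rightarrow> 'a) \<Rightarrow> bool" where
  "periodic_outside K q x \<longleftrightarrow>
     (\<forall>k>K. x (k + q) = x k) \<and> (\<forall>k\<le>-K. x (k - q) = x k)"

lemma periodic_outside_comp: "periodic_outside K q x \<Longrightarrow> periodic_outside K q (g \<circ> x)"
  by (simp add: periodic_outside_def)

lemma ultimately_periodic_mult:
  fixes s :: "nat \<Rightarrow> 'a"
  assumes "\<And>n. n \<ge> N \<Longrightarrow> s (n + p) = s n" "n \<ge> N"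
  shows "s (n + m * p) = s n"
proof (induction m)
  case (Suc m)
  then show ?case
    using assms(1)[of "n + m * p"] assms(2) by (simp add: algebra_simps)
qed simp

lemma periodic_outside_exists:
  assumes "ultimately_periodic_frontier x"
  obtains K q where "K \<ge> 0" "q \<ge> 1" "periodic_outside K q x"
proof -
  obtain N1 p1 where p1: "p1 \<ge> 1" "\<And>n. n \<ge> N1 \<Longrightarrow> x (int (n + p1)) = x (int n)"
    using assms unfolding ultimately_periodic_frontier_def ultimately_periodic_def by blast
  obtain N2 p2 where p2: "p2 \<ge> 1" "\<And>n. n \<ge> N2 \<Longrightarrow> x (- int (n + p2)) = x (- int n)"
    using assms unfolding ultimately_periodic_frontier_def ultimately_periodic_def by blast
  show thesis
  proof (rule that[of "int (max N1 N2)" "int (p1 * p2)"])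
    show "int (max N1 N2) \<ge> 0" by simp
    show "int (p1 * p2) \<ge> 1" using p1(1) p2(1) by (simp add: Suc_le_eq int_one_le_iff_zero_less)
    show "periodic_outside (int (max N1 N2)) (int (p1 * p2)) x"
      unfolding periodic_outside_def
    proof (intro conjI allI impI)
      fix k assume k: "int (max N1 N2) < k"
      then have "x (int (nat k + p2 * p1)) = x (int (nat k))"
        by (intro ultimately_periodic_mult[of N1 "\<lambda>n. x (int n)"]) (use p1 in auto)
      then show "x (k + int (p1 * p2)) = x k"
        using k by (simp add: mult.commute)
    next
      fix k assume k: "k \<le> - int (max N1 N2)"
      then have "x (- int (nat (- k) + p1 * p2)) = x (- int (nat (- k)))"
        by (intro ultimately_periodic_mult[of N2 "\<lambda>n. x (- int n)"]) (use p2 in auto)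
      moreover have "- int (nat (- k) + p1 * p2) = k - int (p1 * p2)" "- int (nat (- k)) = k"
        using k by auto
      ultimately show "x (k - int (p1 * p2)) = x k" by simp
    qed
  qed
qed

lemma periodic_outside_mult:
  assumes "periodic_outside K q x" "q \<ge> 0"
  shows "k > K \<Longrightarrow> x (k + int m * q) = x k" and "k \<le> - K \<Longrightarrow> x (k - int m * q) = x k"
proof -
  show "x (k + int m * q) = x k" if "k > K"
  proof (induction m)
    case (Suc m)
    have "0 \<le> int m * q" using assms(2) by simp
    then have "k + int m * q > K" using that by linarith
    then have "x (k + int m * q + q) = x (k + int m * q)"
      using assms(1) unfolding periodic_outside_def by blast
    then show ?case
      using Suc by (simp add: algebra_simps)
  qed simp
  show "x (k - int m * q) = x k" if "k \<le> - K"
  proof (induction m)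
    case (Suc m)
    have "0 \<le> int m * q" using assms(2) by simp
    then have "x (k - int m * q - q) = x (k - int m * q)"
      using that assms(1) unfolding periodic_outside_def by simp
    then show ?case
      using Suc by (simp add: algebra_simps)
  qed simp
qed

lemma factor_shift_periodic:
  assumes per: "periodic_outside K q x" and q: "q \<ge> 1" "q dvd d"
    and "d > 0 \<Longrightarrow> K \<le> i" "d < 0 \<Longrightarrow> j \<le> - K"
  shows "factor x (i + d) (j + d) = factor x i j"
proof (rule factor_shift)
  fix k assume k: "i < k" "k \<le> j"
  obtain m where m: "d = q * m" using q(2) by blast
  note mult = periodic_outside_mult[OF per, of k "nat \<bar>m\<bar>"]
  consider "m = 0" | "m > 0" "d > 0" | "m < 0" "d < 0"
    using q(1) m by (cases m "0 :: int" rule: linorder_cases) (auto simp: mult_pos_neg)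
  then show "x (k + d) = x k"
  proof cases
    case 2
    then show ?thesis using mult(1) assms(4) k q m by (simp add: mult.commute)
  next
    case 3
    then show ?thesis using mult(2) assms(5) k q m by (simp add: mult.commute)
  qed (simp add: m)
qed

text \<open>This describes a progression of indices \<open>c + n f\<close> that is constant or moves away from the
  window inside one of the two periodic parts of the word. The stride is a multiple of the period, so that
  moving along by strides does not change the letters met.\<close>

definition outward :: "int \<Rightarrow> int \<Rightarrow> int \<Rightarrow> int \<Rightarrow> bool" where
  "outward K q c f \<longleftrightarrow> q dvd f \<and> (f > 0 \<longrightarrow> K \<le> c) \<and> (f < 0 \<longrightarrow> c \<le> - K)"

lemma outward_advance:
  assumes "outward K q c f" "m \<ge> 0"
  shows "outward K q (c + m * f) f"
proof (cases f "0 :: int" rule: linorder_cases)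
  case less
  then have "m * f \<le> 0" using assms(2) by (simp add: mult_nonneg_nonpos)
  then show ?thesis using assms(1) less by (simp add: outward_def)
next
  case greater
  then have "0 \<le> m * f" using assms(2) by simp
  then show ?thesis using assms(1) greater by (simp add: outward_def)
qed (use assms in \<open>simp add: outward_def\<close>)

text \<open>Passing from \<open>n\<close> to \<open>n + 1\<close> extends the factor by a fixed word on either side. If the end points
  move in opposite directions, or one of them rests, the factor grows at its moving ends by words
  read off in the periodic parts. If both move to the right, the old factor, translated by the
  smaller stride \<open>e\<close>, is a prefix of the new one; if both move to the left, the old factor,
  translated by \<open>f\<close>, is a suffix of it.\<close>

lemma N_rational_factor_progression:
  assumes per: "periodic_outside K q x" and q: "q \<ge> 1"
    and i: "outward K q i e" and j: "outward K q j f" and ij: "i \<le> j" and ef: "e \<le> f"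
  shows "N_rational (\<lambda>n. word_mat (factor x (i + int n * e) (j + int n * f)) $$ (1, 1))"
proof -
  define I J where "I n = i + int n * e" and "J n = j + int n * f" for n
  have Suc: "I (Suc n) = I n + e" "J (Suc n) = J n + f" for n
    by (simp_all add: I_def J_def algebra_simps)
  have IJ: "I n \<le> J n" for n
    using ij ef by (simp add: I_def J_def add_mono mult_left_mono)
  have dvd: "q dvd e" "q dvd f" "q dvd int n * e" "q dvd int n * f" for n
    using i j by (auto simp: outward_def)
  have outI: "outward K q (I n) e" and outJ: "outward K q (J n) f" for n
    unfolding I_def J_def using i j by (auto intro: outward_advance)
  note shift = factor_shift_periodic[OF per q]
  have "\<exists>v w. \<forall>n. factor x (I (Suc n)) (J (Suc n)) = v @ factor x (I n) (J n) @ w"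
  proof -
    consider "e \<le> 0" "0 \<le> f" | "0 < e" | "f < 0" by linarith
    then show ?thesis
    proof cases
      case 1
      show ?thesis
      proof (intro exI allI)
        fix n
        have "factor x (i + e + int n * e) (i + int n * e) = factor x (i + e) i"
          using dvd i 1 by (intro shift) (auto simp: outward_def zero_less_mult_iff mult_less_0_iff)
        then have v: "factor x (I n + e) (I n) = factor x (i + e) i"
          by (simp add: I_def algebra_simps)
        have "factor x (j + int n * f) (j + f + int n * f) = factor x j (j + f)"
          using dvd j 1 by (intro shift) (auto simp: outward_def zero_less_mult_iff mult_less_0_iff)
        then have w: "factor x (J n) (J n + f) = factor x j (j + f)"
          by (simp add: J_def algebra_simps)
        have "factor x (I n + e) (J n + f) =
            factor x (I n + e) (I n) @ factor x (I n) (J n) @ factor x (J n) (J n + f)"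
          using 1 IJ[of n]
          by (simp add: factor_append[of "I n + e" "I n" "J n + f"]
              factor_append[of "I n" "J n" "J n + f"])
        then show "factor x (I (Suc n)) (J (Suc n)) =
            factor x (i + e) i @ factor x (I n) (J n) @ factor x j (j + f)"
          by (simp add: Suc v w)
      qed
    next
      case 2
      show ?thesis
      proof (intro exI allI)
        fix n
        have u: "factor x (I n + e) (J n + e) = factor x (I n) (J n)"
          using dvd outI[of n] 2 by (intro shift) (auto simp: outward_def)
        have "factor x (j + e + int n * f) (j + f + int n * f) = factor x (j + e) (j + f)"
          using dvd i ij ef 2 by (intro shift) (auto simp: outward_def zero_less_mult_iff mult_less_0_iff)
        then have w: "factor x (J n + e) (J n + f) = factor x (j + e) (j + f)"
          by (simp add: J_def algebra_simps)
        have "factor x (I n + e) (J n + f) =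
            factor x (I n + e) (J n + e) @ factor x (J n + e) (J n + f)"
          using ef IJ[of n] by (intro factor_append) auto
        then show "factor x (I (Suc n)) (J (Suc n)) =
            [] @ factor x (I n) (J n) @ factor x (j + e) (j + f)"
          by (simp add: Suc u w)
      qed
    next
      case 3
      show ?thesis
      proof (intro exI allI)
        fix n
        have u: "factor x (I n + f) (J n + f) = factor x (I n) (J n)"
          using dvd outJ[of n] 3 by (intro shift) (auto simp: outward_def)
        have "factor x (i + e + int n * e) (i + f + int n * e) = factor x (i + e) (i + f)"
          using dvd i ij ef 3 by (intro shift) (auto simp: outward_def zero_less_mult_iff mult_less_0_iff)
        then have v: "factor x (I n + e) (I n + f) = factor x (i + e) (i + f)"
          by (simp add: I_def algebra_simps)
        have "factor x (I n + e) (J n + f) =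
            factor x (I n + e) (I n + f) @ factor x (I n + f) (J n + f)"
          using ef IJ[of n] by (intro factor_append) auto
        then show "factor x (I (Suc n)) (J (Suc n)) =
            factor x (i + e) (i + f) @ factor x (I n) (J n) @ []"
          by (simp add: Suc u v)
      qed
    qed
  qed
  then obtain v w where vw: "\<And>n. factor x (I (Suc n)) (J (Suc n)) = v @ factor x (I n) (J n) @ w"
    by blast
  show ?thesis
    unfolding I_def[symmetric] J_def[symmetric]
  proof (rule N_rational_corner_entry[of "word_mat v" "word_mat w"])
    show "word_mat (factor x (I (Suc n)) (J (Suc n))) =
        word_mat v * word_mat (factor x (I n) (J n)) * word_mat w" for n
      unfolding vw word_mat_append by (rule assoc_mult_mat[of _ 2 2 _ 2 _ 2, symmetric]) simp_all
  qed simp_all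
qed

lemma N_rational_one_sided:
  assumes emb: "frontier_embedding x P" and t: "associated_tiling P t"
    and per: "periodic_outside K q x" and q: "q \<ge> 1"
    and i: "outward K q i e" and j: "outward K q j f" and ij: "i \<le> j" and ef: "e \<le> f"
    and s: "\<And>n. t (fst (P (j + int n * f)), snd (P (i + int n * e))) = of_nat (s n)"
  shows "N_rational s"
proof -
  have "s n = word_mat (factor x (i + int n * e) (j + int n * f)) $$ (1, 1)" for n
  proof -
    have "i + int n * e \<le> j + int n * f"
      using ij ef by (simp add: add_mono mult_left_mono)
    from tiling_eq_word_mat[OF emb t this] show ?thesis by (simp add: s)
  qed
  then have "s = (\<lambda>n. word_mat (factor x (i + int n * e) (j + int n * f)) $$ (1, 1))" by blast
  then show ?thesis
    using N_rational_factor_progression[OF per q i j ij ef] by simp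
qed

section \<open>Frontier points on the rows and columns of a ray\<close>

text \<open>The coordinate along a periodic end of the frontier behaves like this walk: a jump in one period
  makes every period advance by the same positive amount, so the walk is unbounded and, moving by
  unit steps, meets every value beyond its start.\<close>

lemma periodic_walk:
  fixes G :: "nat \<Rightarrow> int"
  assumes step: "\<And>n. G (Suc n) - G n \<in> {0, 1}"
    and per: "\<And>n. G (Suc (n + p)) - G (n + p) = G (Suc n) - G n" and p: "p \<ge> 1"
    and jump: "G (Suc k) \<noteq> G k"
  shows "\<exists>\<alpha>\<ge>1. (\<forall>n m. G (n + m * p) = G n + int m * \<alpha>) \<and> (\<forall>w\<ge>G 0. \<exists>n. G n = w)"
proof -
  have mono: "mono G"
  proof (rule incseq_SucI)
    show "G n \<le> G (Suc n)" for n using step[of n] by auto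
  qed
  define \<alpha> where "\<alpha> = G p - G 0"
  have add: "G (n + p) = G n + \<alpha>" for n
  proof (induction n)
    case (Suc n)
    then show ?case using per[of n] by simp
  qed (simp add: \<alpha>_def)
  have mult: "G (n + m * p) = G n + int m * \<alpha>" for n m
  proof (induction m)
    case (Suc m)
    then show ?case using add[of "n + m * p"] by (simp add: algebra_simps)
  qed simp
  have "G (Suc k) \<le> G (k + p)" using monoD[OF mono, of "Suc k" "k + p"] p by simp
  moreover have "G (Suc k) - G k = 0 \<or> G (Suc k) - G k = 1" using step[of k] by simp
  ultimately have \<alpha>1: "\<alpha> \<ge> 1" using add[of k] jump by linarith
  have "\<exists>n. G n = w" if w: "w \<ge> G 0" for w
  proof -
    have diff: "\<forall>n<m. \<bar>G (n + 1) - G n\<bar> \<le> 1" for m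
    proof (intro allI impI)
      fix n
      have "G (Suc n) - G n = 0 \<or> G (Suc n) - G n = 1" using step[of n] by simp
      then show "\<bar>G (n + 1) - G n\<bar> \<le> 1" by auto
    qed
    have "w - G 0 \<le> (w - G 0) * \<alpha>" using mult_left_mono[OF \<alpha>1, of "w - G 0"] w by simp
    then have "w \<le> G (nat (w - G 0) * p)"
      using mult[of 0 "nat (w - G 0)"] w by simp
    then show ?thesis
      using nat0_intermed_int_val[OF diff w] by blast
  qed
  then show ?thesis using \<alpha>1 mult by blast
qed

lemma admissible_letters:
  assumes "admissible x"
  shows "\<exists>k\<ge>int N. x k = c" and "\<exists>k\<le>- int N. x k = c"
proof -
  define c' where "c' = (if c = X then Y else X)"
  have c': "l \<noteq> c' \<Longrightarrow> l = c" for l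
    by (cases l; cases c) (auto simp: c'_def)
  have "\<exists>n\<ge>N. x (int n) \<noteq> c'" "\<exists>n\<ge>N. x (- int n) \<noteq> c'"
    using assms unfolding admissible_def ultimately_constant_def by blast+
  then obtain n m where "n \<ge> N" "x (int n) = c" "m \<ge> N" "x (- int m) = c"
    using c' by blast
  then show "\<exists>k\<ge>int N. x k = c" "\<exists>k\<le>- int N. x k = c"
    by (intro exI[of _ "int n"] exI[of _ "- int m"]; simp)+
qed

text \<open>Far out, one period of the frontier advances by a fixed number of columns: \<open>\<alpha>\<close> on the right
  and \<open>\<beta>\<close> on the left. When the horizontal step \<open>a\<close> of a ray is a multiple of both, moving by \<open>a\<close>
  columns is therefore moving by a fixed number of periods along the frontier, in the part
  on the right or on the left according to the sign of \<open>a\<close>.\<close>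

lemma column_progression:
  assumes adm: "admissible x" and emb: "frontier_embedding x P"
    and per: "periodic_outside K q x" and q: "q \<ge> 1" and K: "K \<ge> 0"
  obtains p where "p \<ge> 1"
    "\<And>a u. p dvd a \<Longrightarrow> \<exists>c f N. outward K q (c + int N * f) f \<and>
       (\<forall>n\<ge>N. fst (P (c + int n * f)) = u + int n * a)"
proof -
  define F where "F k = fst (P k)" for k
  have F: "F k - F (k - 1) = (if x k = X then 1 else 0)" for k
    using frontier_step[OF emb, of k] by (cases "x k") (simp_all add: F_def)
  obtain k where k: "k \<ge> int (nat (K + 1))" "x k = X"
    using admissible_letters(1)[OF adm, of "nat (K + 1)" X] by blast
  have "\<exists>\<alpha>\<ge>1. (\<forall>n m. F (K + int (n + m * nat q)) = F (K + int n) + int m * \<alpha>) \<and>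
      (\<forall>w\<ge>F (K + int 0). \<exists>n. F (K + int n) = w)"
  proof (rule periodic_walk[of "\<lambda>n. F (K + int n)" "nat q" "nat (k - K - 1)"])
    have st: "F (K + int (Suc n)) - F (K + int n) = (if x (K + int n + 1) = X then 1 else 0)" for n
      using F[of "K + int n + 1"] by (simp add: algebra_simps)
    show "F (K + int (Suc n)) - F (K + int n) \<in> {0, 1}" for n by (simp only: st) simp
    show "F (K + int (Suc (n + nat q))) - F (K + int (n + nat q)) =
        F (K + int (Suc n)) - F (K + int n)" for n
    proof -
      have "x (K + int n + 1 + q) = x (K + int n + 1)" using per by (simp add: periodic_outside_def)
      moreover have "K + int (n + nat q) + 1 = K + int n + 1 + q" using q by simp
      ultimately show ?thesis unfolding st by (simp only:)
    qed
    show "nat q \<ge> 1" using q by simp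
    have "K + int (nat (k - K - 1)) + 1 = k" using k K by simp
    then have "F (K + int (Suc (nat (k - K - 1)))) - F (K + int (nat (k - K - 1))) = 1"
      unfolding st using k by simp
    then show "F (K + int (Suc (nat (k - K - 1)))) \<noteq> F (K + int (nat (k - K - 1)))" by linarith
  qed
  then obtain \<alpha> where \<alpha>: "\<alpha> \<ge> 1"
    and right: "\<And>n m. F (K + int (n + m * nat q)) = F (K + int n) + int m * \<alpha>"
    and right_ex0: "\<And>w. w \<ge> F (K + int 0) \<Longrightarrow> \<exists>n. F (K + int n) = w"
    by blast
  have right_ex: "\<exists>n. F (K + int n) = w" if "w \<ge> F K" for w
    by (rule right_ex0) (use that in simp)
  obtain k' where k': "k' \<le> - int (nat K)" "x k' = X"
    using admissible_letters(2)[OF adm, of "nat K" X] by blast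
  have "\<exists>\<beta>\<ge>1. (\<forall>n m. - F (- K - int (n + m * nat q)) = - F (- K - int n) + int m * \<beta>) \<and>
      (\<forall>w\<ge>- F (- K - int 0). \<exists>n. - F (- K - int n) = w)"
  proof (rule periodic_walk[of "\<lambda>n. - F (- K - int n)" "nat q" "nat (- k' - K)"])
    have st: "- F (- K - int (Suc n)) - - F (- K - int n) = (if x (- K - int n) = X then 1 else 0)" for n
      using F[of "- K - int n"] by (simp add: algebra_simps)
    show "- F (- K - int (Suc n)) - - F (- K - int n) \<in> {0, 1}" for n by (simp only: st) simp
    show "- F (- K - int (Suc (n + nat q))) - - F (- K - int (n + nat q)) =
        - F (- K - int (Suc n)) - - F (- K - int n)" for n
    proof -
      have "x (- K - int n - q) = x (- K - int n)" using per by (simp add: periodic_outside_def)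
      moreover have "- K - int (n + nat q) = - K - int n - q" using q by simp
      ultimately show ?thesis unfolding st by (simp only:)
    qed
    show "nat q \<ge> 1" using q by simp
    have "- K - int (nat (- k' - K)) = k'" using k' K by simp
    then have "- F (- K - int (Suc (nat (- k' - K)))) - - F (- K - int (nat (- k' - K))) = 1"
      unfolding st using k' by simp
    then show "- F (- K - int (Suc (nat (- k' - K)))) \<noteq> - F (- K - int (nat (- k' - K)))" by linarith
  qed
  then obtain \<beta> where \<beta>: "\<beta> \<ge> 1"
    and left: "\<And>n m. - F (- K - int (n + m * nat q)) = - F (- K - int n) + int m * \<beta>"
    and left_ex0: "\<And>w. w \<ge> - F (- K - int 0) \<Longrightarrow> \<exists>n. - F (- K - int n) = w"
    by blast
  have left_ex: "\<exists>n. - F (- K - int n) = w" if "w \<ge> - F (- K)" for w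
    by (rule left_ex0) (use that in simp)
  \<comment> \<open>A vertical ray needs a frontier point in a column that may lie within the window.\<close>
  have surj: "\<exists>k. F k = u" for u
  proof -
    obtain n where n: "F (K + int n) = max u (F K)" using right_ex[of "max u (F K)"] by auto
    obtain m where m: "- F (- K - int m) = max (- u) (- F (- K))"
      using left_ex[of "max (- u) (- F (- K))"] by auto
    have "\<exists>i\<le>nat (2 * K) + m + n. F (- K - int m + int i) = u"
    proof (rule nat0_intermed_int_val)
      show "\<forall>i<nat (2 * K) + m + n. \<bar>F (- K - int m + int (i + 1)) - F (- K - int m + int i)\<bar> \<le> 1"
      proof (intro allI impI)
        fix i
        show "\<bar>F (- K - int m + int (i + 1)) - F (- K - int m + int i)\<bar> \<le> 1"
          using F[of "- K - int m + int (i + 1)"] by (simp add: algebra_simps)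
      qed
      show "F (- K - int m + int 0) \<le> u" using m by simp
      have "- K - int m + int (nat (2 * K) + m + n) = K + int n" using K by simp
      then show "u \<le> F (- K - int m + int (nat (2 * K) + m + n))" using n by simp
    qed
    then show ?thesis by blast
  qed
  show thesis
  proof (rule that[of "\<alpha> * \<beta>"])
    show "\<alpha> * \<beta> \<ge> 1" using mult_mono[OF \<alpha> \<beta>] \<alpha> by simp
    fix a u assume "\<alpha> * \<beta> dvd a"
    then obtain a1 where a1: "a = \<alpha> * \<beta> * a1" by blast
    consider "a = 0" | "a1 > 0" "a \<ge> 1" | "a1 < 0" "- a \<ge> 1"
    proof (cases a1 "0 :: int" rule: linorder_cases)
      case less
      have "\<alpha> * \<beta> * a1 < 0" using less \<alpha> \<beta> by (intro mult_pos_neg mult_pos_pos) auto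
      then show ?thesis using that(3) less a1 by auto
    next
      case greater
      have "\<alpha> * \<beta> * a1 > 0" using greater \<alpha> \<beta> by (intro mult_pos_pos) auto
      then show ?thesis using that(2) greater a1 by auto
    qed (use a1 that(1) in simp)
    then show "\<exists>c f N. outward K q (c + int N * f) f \<and>
       (\<forall>n\<ge>N. fst (P (c + int n * f)) = u + int n * a)"
    proof cases
      case 1
      obtain k where "F k = u" using surj by blast
      then show ?thesis
        using 1 by (intro exI[of _ k] exI[of _ 0]) (simp add: outward_def F_def)
    next
      case 2
      \<comment> \<open>Every step of the ray advances by at least one column, so this many steps reach the right part.\<close>
      define N where "N = nat (F K - u)"
      have "int N \<le> int N * a" using mult_left_mono[OF 2(2), of "int N"] by simp
      moreover have "F K - u \<le> int N" by (simp add: N_def)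
      ultimately have "u + int N * a \<ge> F K" by linarith
      then obtain k where k: "F (K + int k) = u + int N * a" using right_ex by blast
      define f where "f = \<beta> * a1 * q"
      define c where "c = K + int k - int N * f"
      have f: "f > 0" using \<beta> 2(1) q unfolding f_def by (intro mult_pos_pos) auto
      have "fst (P (c + int n * f)) = u + int n * a" if n: "n \<ge> N" for n
      proof -
        define m where "m = (n - N) * nat (\<beta> * a1)"
        have "\<beta> * a1 \<ge> 0" using \<beta> 2(1) by (intro mult_nonneg_nonneg) auto
        then have m: "int m = (int n - int N) * (\<beta> * a1)"
          using n by (simp add: m_def of_nat_diff)
        have "c + int n * f = K + int (k + m * nat q)"
          using q by (simp add: m c_def f_def algebra_simps)
        then have "F (c + int n * f) = u + int N * a + int m * \<alpha>"
          by (simp only: right k)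
        also have "\<dots> = u + int n * a"
          by (simp add: m a1 algebra_simps)
        finally show ?thesis by (simp add: F_def)
      qed
      moreover have "outward K q (c + int N * f) f"
        using f by (simp add: outward_def c_def f_def)
      ultimately show ?thesis by blast
    next
      case 3
      define N where "N = nat (u - F (- K))"
      have "int N \<le> int N * - a" using mult_left_mono[OF 3(2), of "int N"] by simp
      moreover have "u - F (- K) \<le> int N" by (simp add: N_def)
      ultimately have "- (u + int N * a) \<ge> - F (- K)" by (simp add: algebra_simps)
      then obtain k where k: "- F (- K - int k) = - (u + int N * a)" using left_ex by blast
      define f where "f = \<alpha> * a1 * q"
      define c where "c = - K - int k - int N * f"
      have f: "f < 0" using \<alpha> 3(1) q unfolding f_def by (intro mult_neg_pos mult_pos_neg) auto
      have "fst (P (c + int n * f)) = u + int n * a" if n: "n \<ge> N" for n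
      proof -
        define m where "m = (n - N) * nat (\<alpha> * - a1)"
        have "\<alpha> * - a1 \<ge> 0" using \<alpha> 3 by (intro mult_nonneg_nonneg) auto
        then have m: "int m = (int n - int N) * (\<alpha> * - a1)"
          using n by (simp add: m_def of_nat_diff)
        have "c + int n * f = - K - int (k + m * nat q)"
          using q by (simp add: m c_def f_def algebra_simps)
        then have "- F (c + int n * f) = - (u + int N * a) + int m * \<beta>"
          by (simp only: left k)
        then have "F (c + int n * f) = u + int n * a"
          by (simp add: m a1 algebra_simps)
        then show ?thesis by (simp add: F_def)
      qed
      moreover have "outward K q (c + int N * f) f"
        using f by (simp add: outward_def c_def f_def)
      ultimately show ?thesis by blast
    qed
  qed
qed

section \<open>Rays of the tiling\<close>

lemma outward_later:
  assumes "outward K q (c + int N * f) f" "N \<le> N'"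
  shows "outward K q (c + int N' * f) f"
  using outward_advance[OF assms(1), of "int (N' - N)"] assms(2)
  by (simp add: of_nat_diff algebra_simps)

lemma progressions_eventually_ordered:
  fixes c d e f :: int
  obtains N where "N \<ge> N0" "e \<le> f" "c + int N * e \<le> d + int N * f"
  | N where "N \<ge> N0" "f \<le> e" "d + int N * f \<le> c + int N * e"
proof -
  define N where "N = N0 + nat \<bar>c - d\<bar>"
  have N: "N \<ge> N0" "c - d \<le> int N" "d - c \<le> int N" by (auto simp: N_def)
  have "int N * 1 \<le> int N * (f - e)" if "e < f" using that by (intro mult_left_mono) auto
  moreover have "int N * 1 \<le> int N * (e - f)" if "f < e" using that by (intro mult_left_mono) auto
  ultimately show thesis
    using that N by (cases e f rule: linorder_cases; cases "c \<le> d") (auto simp: algebra_simps)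
qed

text \<open>At time \<open>n\<close> the ray is on or below the frontier if the index \<open>c + n e\<close> of its row is at most the
  index \<open>d + n f\<close> of its column, and on or above it in the opposite case. Two arithmetic progressions are
  eventually ordered in one of the two ways, and the reflected frontier reduces the second to the
  first.\<close>

lemma ray_progression_N_rational:
  assumes emb: "frontier_embedding x P" and t: "associated_tiling P t"
    and per: "periodic_outside K q x" and q: "q \<ge> 1"
    and row: "outward K q (c + int N1 * e) e" "\<And>n. n \<ge> N1 \<Longrightarrow> snd (P (c + int n * e)) = v + int n * b"
    and col: "outward K q (d + int N2 * f) f" "\<And>n. n \<ge> N2 \<Longrightarrow> fst (P (d + int n * f)) = u + int n * a"
    and s: "\<And>n. t (u + int n * a, v + int n * b) = of_nat (s n)"
  shows "N_rational s"
proof -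
  have add: "k + int N * h + int n * h = k + int (N + n) * h" for k h :: int and N n
    by (simp add: algebra_simps)
  show ?thesis
  proof (rule progressions_eventually_ordered[of "max N1 N2" e f c d])
    fix N assume N: "N \<ge> max N1 N2" "e \<le> f" "c + int N * e \<le> d + int N * f"
    have "N_rational (\<lambda>n. s (N + n))"
    proof (rule N_rational_one_sided[OF emb t per q _ _ N(3,2)])
      show "outward K q (c + int N * e) e" "outward K q (d + int N * f) f"
        using row(1) col(1) N by (auto elim: outward_later)
      show "t (fst (P (d + int N * f + int n * f)), snd (P (c + int N * e + int n * e))) =
          of_nat (s (N + n))" for n
        using N s[of "N + n"] by (simp only: add row(2) col(2) max.bounded_iff trans_le_add1)
    qed
    then show ?thesis by (rule N_rational_offset)
  next
    fix N assume N: "N \<ge> max N1 N2" "f \<le> e" "d + int N * f \<le> c + int N * e"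
    have "N_rational (\<lambda>n. s (N + n))"
    proof (rule N_rational_one_sided[OF frontier_embedding_flip[OF emb] associated_tiling_flip[OF t]
          periodic_outside_comp[OF per] q _ _ N(3,2)])
      show "outward K q (c + int N * e) e" "outward K q (d + int N * f) f"
        using row(1) col(1) N by (auto elim: outward_later)
      show "(t \<circ> reflect) (fst ((reflect \<circ> P) (c + int N * e + int n * e)),
          snd ((reflect \<circ> P) (d + int N * f + int n * f))) = of_nat (s (N + n))" for n
      proof -
        have "(t \<circ> reflect) (fst ((reflect \<circ> P) k), snd ((reflect \<circ> P) l)) = t (fst (P l), snd (P k))"
          for k l by (simp add: reflect_def split_def)
        then show ?thesis
          using N s[of "N + n"] by (simp only: add row(2) col(2) max.bounded_iff trans_le_add1)
      qed
    qed
    then show ?thesis by (rule N_rational_offset)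
  qed
qed

theorem theorem6p1:
  fixes x :: "int \<Rightarrow> letter" and P :: "int \<Rightarrow> int \<times> int"
    and t :: "int \<times> int \<Rightarrow> rat" and M V :: "int \<times> int"
  assumes "admissible x"
    and "ultimately_periodic_frontier x"
    and "frontier_embedding x P"
    and "associated_tiling P t"
    and "V \<noteq> (0, 0)"
  shows "\<exists>a :: nat \<Rightarrow> nat. (\<forall>n. ray t M V n = of_nat (a n)) \<and> N_rational a"
proof -
  note emb = assms(3) and t = assms(4)
  obtain K q where K: "K \<ge> 0" and q: "q \<ge> 1" and per: "periodic_outside K q x"
    using periodic_outside_exists[OF assms(2)] by blast
  obtain p1 where p1: "p1 \<ge> 1" and col: "\<And>a u. p1 dvd a \<Longrightarrow> \<exists>c f N.
      outward K q (c + int N * f) f \<and> (\<forall>n\<ge>N. fst (P (c + int n * f)) = u + int n * a)"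
    by (rule column_progression[OF assms(1) emb per q K]) (rule that)
  obtain p2 where p2: "p2 \<ge> 1" and col': "\<And>a u. p2 dvd a \<Longrightarrow> \<exists>c f N.
      outward K q (c + int N * f) f \<and>
      (\<forall>n\<ge>N. fst ((reflect \<circ> P) (c + int n * f)) = u + int n * a)"
    by (rule column_progression[OF admissible_flip[OF assms(1)] frontier_embedding_flip[OF emb]
          periodic_outside_comp[OF per] q K]) (rule that)
  \<comment> \<open>The rows of the frontier are, up to sign, the columns of the reflected frontier.\<close>
  have row: "\<exists>c e N. outward K q (c + int N * e) e \<and>
      (\<forall>n\<ge>N. snd (P (c + int n * e)) = v + int n * b)" if "p2 dvd b" for b v
  proof -
    have "p2 dvd - b" using that by simp
    from col'[OF this, of "- v"] obtain c e N where "outward K q (c + int N * e) e"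
      and *: "\<And>n. n \<ge> N \<Longrightarrow> fst ((reflect \<circ> P) (c + int n * e)) = - v + int n * - b"
      by blast
    moreover have "snd (P (c + int n * e)) = v + int n * b" if "n \<ge> N" for n
      using *[OF that] by (simp add: reflect_def split_def)
    ultimately show ?thesis by blast
  qed
  have nat: "\<exists>m :: nat. t (u, v) = of_nat m" for u v
  proof -
    obtain j where j: "fst (P j) = u" using col[of 0 u] by auto
    obtain i where i: "snd (P i) = v" using row[of 0 v] by auto
    show ?thesis
    proof (cases "i \<le> j")
      case True
      then show ?thesis using tiling_eq_word_mat[OF emb t True] i j by auto
    next
      case False
      then have "j \<le> i" by simp
      from tiling_eq_word_mat[OF frontier_embedding_flip[OF emb] associated_tiling_flip[OF t] this]
      show ?thesis using i j by (auto simp: reflect_def split_def)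
    qed
  qed
  have "\<exists>s. \<forall>n. ray t M V n = of_nat (s n)"
    unfolding ray_def using nat by (intro choice) blast
  then obtain s where s: "\<And>n. ray t M V n = of_nat (s n)" by blast
  \<comment> \<open>Every \<open>p\<close>-th point of the ray is taken, so that its steps are multiples of both \<open>p1\<close> and \<open>p2\<close>.\<close>
  define p where "p = p1 * p2"
  have p0: "p \<ge> 1" using mult_mono[OF p1 p2] p1 by (simp add: p_def)
  have "N_rational s"
  proof (rule N_rational_interleave)
    show "nat p \<ge> 1" using p0 by simp
    fix r
    define u v where "u = fst M + int r * fst V" and "v = snd M + int r * snd V"
    obtain d f N2 where d: "outward K q (d + int N2 * f) f"
        "\<And>n. n \<ge> N2 \<Longrightarrow> fst (P (d + int n * f)) = u + int n * (p * fst V)"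
      using col[of "p * fst V" u] by (auto simp: p_def)
    obtain c e N1 where c: "outward K q (c + int N1 * e) e"
        "\<And>n. n \<ge> N1 \<Longrightarrow> snd (P (c + int n * e)) = v + int n * (p * snd V)"
      using row[of "p * snd V" v] by (auto simp: p_def)
    show "N_rational (\<lambda>n. s (nat p * n + r))"
    proof (rule ray_progression_N_rational[OF emb t per q c d])
      fix n
      have "int (nat p * n + r) = int n * p + int r" using p0 by simp
      then have "ray t M V (nat p * n + r) = t (u + int n * (p * fst V), v + int n * (p * snd V))"
        by (simp only: ray_def u_def v_def) (simp add: algebra_simps)
      then show "t (u + int n * (p * fst V), v + int n * (p * snd V)) = of_nat (s (nat p * n + r))"
        by (simp add: s)
    qed
  qed
  then show ?thesis using s by blast
qed

end
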